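(* Let $G=H\rtimes K$ be a semidirect product of groups and let $\theta=\begin{pmatrix}\alpha&\beta\\ \gamma&\delta\end{pmatrix}\in End(G)$ be such that $\delta: K\to K$ is invertible. Then $\theta$ is invertible (i.e. an automorphism of $G$) if and only if the map $\det_{H}(\theta)=\alpha-\beta\delta^{-1}\gamma: H\to H$, that is, $h\mapsto \alpha(h)\big(\beta(\delta^{-1}(\gamma(h)))\big)^{-1}$, is invertible.
   Context: $K$ acts on $H$ by automorphisms, written $h^{k}$; in $G=H\rtimes K$ we have $h^{k}=khk^{-1}$ and every element of $G$ is uniquely $hk$ with $h\in H$, $k\in K$. An endomorphism $\theta$ of $G$ is identified with the matrix $\begin{pmatrix}\alpha&\beta\\ \gamma&\delta\end{pmatrix}$ of maps $\alpha:H\to H$, $\beta:K\to H$, $\gamma:H\to K$, $\delta:K\to K$ determined by $\theta(h)=\alpha(h)\gamma(h)$ and $\theta(k)=\beta(k)\delta(k)$ for all $h\in H$, $k\in K$. Here $\gamma$ and $\delta$ are group homomorphisms, while $\alpha$ and $\beta$ are only maps of sets, satisfying $\alpha(hh')=\alpha(h)\alpha(h')^{\gamma(h)}$, $\beta(kk')=\beta(k)\beta(k')^{\delta(k)}$, $\gamma(h^{k})\delta(k)=\delta(k)\gamma(h)$, $\alpha(h^{k})\beta(k)^{\gamma(h^{k})}=\beta(k)\alpha(h)^{\delta(k)}$. "Invertible" for a map means bijective. Sums and negatives of maps are pointwise: $(\phi+\psi)(u)=\phi(u)\psi(u)$, $(-\phi)(u)=\phi(u)^{-1}$, and $\phi-\psi=\phi+(-\psi)$;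 juxtaposition is composition. *)

theory Defs
  imports "HOL-Algebra.Bij"
begin

text \<open>
  The semidirect product of H and K with respect to an action \<open>\<phi>\<close> of K on H, the action being
  a homomorphism from K into the automorphism group of H. The subgroups H and K of the product are
  embedded as \<open>h \<mapsto> (h, 1)\<close> and \<open>k \<mapsto> (1, k)\<close>, so that the pair \<open>(h, k)\<close> is the product \<open>hk\<close>.
\<close>

definition semidirect ::
  "('a, 'c) monoid_scheme \<Rightarrow> ('b, 'd) monoid_scheme \<Rightarrow> ('b \<Rightarrow> 'a \<Rightarrow> 'a) \<Rightarrow> ('a \<times> 'b) monoid"
  where "semidirect H K \<phi> =
    \<lparr>carrier = carrier H \<times> carrier K,
     mult = \<lambda>(h, k) (h', k'). (h \<otimes>\<^bsub>H\<^esub> \<phi> k h', k \<otimes>\<^bsub>K\<^esub> k'),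
     one = (\<one>\<^bsub>H\<^esub>, \<one>\<^bsub>K\<^esub>)\<rparr>"

lemma semidirect_simps:
  "carrier (semidirect H K \<phi>) = carrier H \<times> carrier K"
  "(h, k) \<otimes>\<^bsub>semidirect H K \<phi>\<^esub> (h', k') = (h \<otimes>\<^bsub>H\<^esub> \<phi> k h', k \<otimes>\<^bsub>K\<^esub> k')"
  "\<one>\<^bsub>semidirect H K \<phi>\<^esub> = (\<one>\<^bsub>H\<^esub>, \<one>\<^bsub>K\<^esub>)"
  by (simp_all add: semidirect_def)

lemma action_facts:
  assumes "group H" "group K" "\<phi> \<in> hom K (AutoGroup H)"
  shows "k \<in> carrier K \<Longrightarrow> \<phi> k \<in> hom H H"
    and "k \<in> carrier K \<Longrightarrow> h \<in> carrier H \<Longrightarrow> \<phi> k h \<in> carrier H"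
    and "k \<in> carrier K \<Longrightarrow> \<phi> k \<one>\<^bsub>H\<^esub> = \<one>\<^bsub>H\<^esub>"
    and "k \<in> carrier K \<Longrightarrow> k' \<in> carrier K \<Longrightarrow> h \<in> carrier H \<Longrightarrow>
           \<phi> (k \<otimes>\<^bsub>K\<^esub> k') h = \<phi> k (\<phi> k' h)"
    and "h \<in> carrier H \<Longrightarrow> \<phi> \<one>\<^bsub>K\<^esub> h = h"
proof -
  have aut: "\<phi> k \<in> auto H" if "k \<in> carrier K" for k
    using assms(3) that by (auto simp: hom_def AutoGroup_def)
  show 1: "\<phi> k \<in> hom H H" if "k \<in> carrier K" for k
    using aut[OF that] by (simp add: auto_def)
  show "\<phi> k h \<in> carrier H" if "k \<in> carrier K" "h \<in> carrier H" for k h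
    using 1[OF that(1)] that(2) by (rule hom_in_carrier)
  show "\<phi> k \<one>\<^bsub>H\<^esub> = \<one>\<^bsub>H\<^esub>" if "k \<in> carrier K" for k
    using hom_one[OF 1[OF that] assms(1) assms(1)] .
  show "\<phi> (k \<otimes>\<^bsub>K\<^esub> k') h = \<phi> k (\<phi> k' h)"
    if "k \<in> carrier K" "k' \<in> carrier K" "h \<in> carrier H" for k k' h
  proof -
    have "\<phi> (k \<otimes>\<^bsub>K\<^esub> k') = \<phi> k \<otimes>\<^bsub>AutoGroup H\<^esub> \<phi> k'"
      using hom_mult[OF assms(3) that(1,2)] .
    then show ?thesis
      using aut[OF that(1)] aut[OF that(2)] that(3)
      by (simp add: AutoGroup_def BijGroup_def auto_def compose_def)
  qed
  show "\<phi> \<one>\<^bsub>K\<^esub> h = h" if "h \<in> carrier H" for h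
  proof -
    have "\<phi> \<one>\<^bsub>K\<^esub> = \<one>\<^bsub>AutoGroup H\<^esub>"
      using hom_one[OF assms(3,2) group.AutoGroup[OF assms(1)]] .
    then show ?thesis using that by (simp add: AutoGroup_def BijGroup_def)
  qed
qed

lemma group_semidirect:
  assumes "group H" "group K" "\<phi> \<in> hom K (AutoGroup H)"
  shows "group (semidirect H K \<phi>)"
proof -
  interpret H: group H by fact
  interpret K: group K by fact
  note act = action_facts[OF assms]
  show ?thesis
  proof (rule groupI)
    fix x assume "x \<in> carrier (semidirect H K \<phi>)"
    then obtain h k where x: "x = (h, k)" "h \<in> carrier H" "k \<in> carrier K"
      by (auto simp: semidirect_simps)
    let ?y = "(\<phi> (inv\<^bsub>K\<^esub> k) (inv\<^bsub>H\<^esub> h), inv\<^bsub>K\<^esub> k)"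
    have "\<phi> (inv\<^bsub>K\<^esub> k) (inv\<^bsub>H\<^esub> h) \<otimes>\<^bsub>H\<^esub> \<phi> (inv\<^bsub>K\<^esub> k) h = \<one>\<^bsub>H\<^esub>"
      using x hom_mult[OF act(1)[of "inv\<^bsub>K\<^esub> k"], of "inv\<^bsub>H\<^esub> h" h] act(3) by simp
    then show "\<exists>y\<in>carrier (semidirect H K \<phi>). y \<otimes>\<^bsub>semidirect H K \<phi>\<^esub> x = \<one>\<^bsub>semidirect H K \<phi>\<^esub>"
      using x act by (intro bexI[of _ ?y]) (auto simp: semidirect_simps)
  qed (auto simp: semidirect_simps act hom_mult[OF act(1)] H.m_assoc K.m_assoc)
qed

lemma semidirect_decomp_conj:
  assumes "group H" "group K" "\<phi> \<in> hom K (AutoGroup H)" "h \<in> carrier H" "k \<in> carrier K"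
  shows "(h, \<one>\<^bsub>K\<^esub>) \<otimes>\<^bsub>semidirect H K \<phi>\<^esub> (\<one>\<^bsub>H\<^esub>, k) = (h, k)"
    and "(\<one>\<^bsub>H\<^esub>, k) \<otimes>\<^bsub>semidirect H K \<phi>\<^esub> (h, \<one>\<^bsub>K\<^esub>) \<otimes>\<^bsub>semidirect H K \<phi>\<^esub>
           inv\<^bsub>semidirect H K \<phi>\<^esub> (\<one>\<^bsub>H\<^esub>, k) = (\<phi> k h, \<one>\<^bsub>K\<^esub>)"
proof -
  interpret H: group H by fact
  interpret K: group K by fact
  interpret G: group "semidirect H K \<phi>" using assms(1-3) by (rule group_semidirect)
  note act = action_facts[OF assms(1-3)]
  show "(h, \<one>\<^bsub>K\<^esub>) \<otimes>\<^bsub>semidirect H K \<phi>\<^esub> (\<one>\<^bsub>H\<^esub>, k) = (h, k)"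
    using assms(4,5) act by (simp add: semidirect_simps)
  have "inv\<^bsub>semidirect H K \<phi>\<^esub> (\<one>\<^bsub>H\<^esub>, k) = (\<one>\<^bsub>H\<^esub>, inv\<^bsub>K\<^esub> k)"
    using assms(5) act by (intro G.inv_equality) (auto simp: semidirect_simps)
  then show "(\<one>\<^bsub>H\<^esub>, k) \<otimes>\<^bsub>semidirect H K \<phi>\<^esub> (h, \<one>\<^bsub>K\<^esub>) \<otimes>\<^bsub>semidirect H K \<phi>\<^esub>
           inv\<^bsub>semidirect H K \<phi>\<^esub> (\<one>\<^bsub>H\<^esub>, k) = (\<phi> k h, \<one>\<^bsub>K\<^esub>)"
    using assms(4,5) act by (simp add: semidirect_simps)
qed

text \<open>
  The entries of the matrix of an endomorphism \<open>\<theta>\<close> of the semidirect product, i.e. the maps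
  with \<open>\<theta>(h) = \<alpha>(h) \<gamma>(h)\<close> for h in H and \<open>\<theta>(k) = \<beta>(k) \<delta>(k)\<close> for k in K.
  They depend on H and K only through their unit elements.
\<close>

definition end_alpha :: "('b, 'd) monoid_scheme \<Rightarrow> ('a \<times> 'b \<Rightarrow> 'a \<times> 'b) \<Rightarrow> 'a \<Rightarrow> 'a"
  where "end_alpha K \<theta> h = fst (\<theta> (h, \<one>\<^bsub>K\<^esub>))"

definition end_beta :: "('a, 'c) monoid_scheme \<Rightarrow> ('a \<times> 'b \<Rightarrow> 'a \<times> 'b) \<Rightarrow> 'b \<Rightarrow> 'a"
  where "end_beta H \<theta> k = fst (\<theta> (\<one>\<^bsub>H\<^esub>, k))"

definition end_gamma :: "('b, 'd) monoid_scheme \<Rightarrow> ('a \<times> 'b \<Rightarrow> 'a \<times> 'b) \<Rightarrow> 'a \<Rightarrow> 'b"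
  where "end_gamma K \<theta> h = snd (\<theta> (h, \<one>\<^bsub>K\<^esub>))"

definition end_delta :: "('a, 'c) monoid_scheme \<Rightarrow> ('a \<times> 'b \<Rightarrow> 'a \<times> 'b) \<Rightarrow> 'b \<Rightarrow> 'b"
  where "end_delta H \<theta> k = snd (\<theta> (\<one>\<^bsub>H\<^esub>, k))"

lemma end_matrix:
  assumes "group H" "group K" "\<phi> \<in> hom K (AutoGroup H)"
    and "\<theta> \<in> hom (semidirect H K \<phi>) (semidirect H K \<phi>)"
  shows "h \<in> carrier H \<Longrightarrow> end_alpha K \<theta> h \<in> carrier H \<and> end_gamma K \<theta> h \<in> carrier K \<and>
           \<theta> (h, \<one>\<^bsub>K\<^esub>) =
             (end_alpha K \<theta> h, \<one>\<^bsub>K\<^esub>) \<otimes>\<^bsub>semidirect H K \<phi>\<^esub> (\<one>\<^bsub>H\<^esub>, end_gamma K \<theta> h)"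
    and "k \<in> carrier K \<Longrightarrow> end_beta H \<theta> k \<in> carrier H \<and> end_delta H \<theta> k \<in> carrier K \<and>
           \<theta> (\<one>\<^bsub>H\<^esub>, k) =
             (end_beta H \<theta> k, \<one>\<^bsub>K\<^esub>) \<otimes>\<^bsub>semidirect H K \<phi>\<^esub> (\<one>\<^bsub>H\<^esub>, end_delta H \<theta> k)"
proof -
  interpret H: group H by fact
  interpret K: group K by fact
  have car: "\<theta> (h, k) \<in> carrier H \<times> carrier K" if "h \<in> carrier H" "k \<in> carrier K" for h k
    using hom_in_carrier[OF assms(4), of "(h, k)"] that by (simp add: semidirect_simps)
  show "end_alpha K \<theta> h \<in> carrier H \<and> end_gamma K \<theta> h \<in> carrier K \<and>
           \<theta> (h, \<one>\<^bsub>K\<^esub>) =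
             (end_alpha K \<theta> h, \<one>\<^bsub>K\<^esub>) \<otimes>\<^bsub>semidirect H K \<phi>\<^esub> (\<one>\<^bsub>H\<^esub>, end_gamma K \<theta> h)"
    if "h \<in> carrier H" for h
    using car[OF that K.one_closed] semidirect_decomp_conj(1)[OF assms(1-3)]
    by (auto simp: end_alpha_def end_gamma_def mem_Times_iff)
  show "end_beta H \<theta> k \<in> carrier H \<and> end_delta H \<theta> k \<in> carrier K \<and>
           \<theta> (\<one>\<^bsub>H\<^esub>, k) =
             (end_beta H \<theta> k, \<one>\<^bsub>K\<^esub>) \<otimes>\<^bsub>semidirect H K \<phi>\<^esub> (\<one>\<^bsub>H\<^esub>, end_delta H \<theta> k)"
    if "k \<in> carrier K" for k
    using car[OF H.one_closed that] semidirect_decomp_conj(1)[OF assms(1-3)]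
    by (auto simp: end_beta_def end_delta_def mem_Times_iff)
qed

text \<open>
  The map \<open>\<alpha> - \<beta> \<delta>\<^sup>-\<^sup>1 \<gamma>\<close>, with the difference taken pointwise in H; the inverse of \<open>\<delta>\<close> is
  the inverse function on the carrier of K.
\<close>

definition det_H ::
  "('a, 'c) monoid_scheme \<Rightarrow> ('b, 'd) monoid_scheme \<Rightarrow> ('a \<times> 'b \<Rightarrow> 'a \<times> 'b) \<Rightarrow> 'a \<Rightarrow> 'a"
  where "det_H H K \<theta> h =
    end_alpha K \<theta> h \<otimes>\<^bsub>H\<^esub>
      inv\<^bsub>H\<^esub> (end_beta H \<theta> (inv_into (carrier K) (end_delta H \<theta>) (end_gamma K \<theta> h)))"

end

theory Submission
  imports Defs
begin

text \<open>
  Put \<open>x = \<delta>\<^sup>-\<^sup>1(\<gamma>(h))\<close>. Then \<open>\<theta>(h) = det\<^sub>H(h) \<theta>(x)\<close>, hence \<open>\<theta>(hk) = det\<^sub>H(h) \<theta>(xk)\<close>, i.e.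
  \<open>\<theta>(hk) = det\<^sub>H(h) \<beta>(\<delta>\<^sup>-\<^sup>1(k')) k'\<close> with \<open>k' = \<gamma>(h) \<delta>(k)\<close>. The change of variables
  \<open>(h, k) \<mapsto> (h, k')\<close> is a bijection, and what remains is, over each \<open>k'\<close>, the map \<open>det\<^sub>H\<close>
  followed by a right translation of H.
\<close>

text \<open>The second coordinate is preserved, so points over different \<open>b\<close> never
  collide and a preimage of \<open>(y, b)\<close> lies over \<open>b\<close> again. Both halves of
  bijectivity can therefore be tested in each fibre separately.\<close>

lemma bij_betw_skew_iff:
  "bij_betw (\<lambda>(a, b). (f b a, b)) (A \<times> B) (A' \<times> B) \<longleftrightarrow> (\<forall>b\<in>B. bij_betw (f b) A A')"
proof
  assume bij: "bij_betw (\<lambda>(a, b). (f b a, b)) (A \<times> B) (A' \<times> B)"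
  show "\<forall>b\<in>B. bij_betw (f b) A A'"
  proof
    fix b assume b: "b \<in> B"
    show "bij_betw (f b) A A'"
    proof (rule bij_betw_imageI)
      show "inj_on (f b) A"
        using bij_betw_imp_inj_on[OF bij] b by (auto simp: inj_on_def)
      show "f b ` A = A'"
        using bij_betw_imp_surj_on[OF bij] b by (force simp: set_eq_iff image_iff)
    qed
  qed
next
  assume "\<forall>b\<in>B. bij_betw (f b) A A'"
  then show "bij_betw (\<lambda>(a, b). (f b a, b)) (A \<times> B) (A' \<times> B)"
    by (fastforce simp: bij_betw_def inj_on_def)
qed

lemma bij_betw_skew:
  assumes "\<And>a. a \<in> A \<Longrightarrow> bij_betw (f a) B B'"
  shows "bij_betw (\<lambda>(a, b). (a, f a b)) (A \<times> B) (A \<times> B')"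
  using assms by (fastforce simp: bij_betw_def inj_on_def)

lemma (in group) bij_betw_mult_left:
  assumes "c \<in> carrier G"
  shows "bij_betw (\<lambda>x. c \<otimes> x) (carrier G) (carrier G)"
  using inj_on_cmult[OF assms] surj_const_mult[OF assms] by (simp add: bij_betw_def)

lemma (in group) bij_betw_mult_right:
  assumes "c \<in> carrier G"
  shows "bij_betw (\<lambda>x. x \<otimes> c) (carrier G) (carrier G)"
  using assms by (intro bij_betw_byWitness[where f' = "\<lambda>x. x \<otimes> inv c"]) (auto simp: m_assoc)

text \<open>The dependence of \<open>\<theta>\<close> on \<open>k\<close> is moved into
  \<open>k'\<close>, so that \<open>det_H\<close> applied to \<open>h\<close> alone remains on the
  left. This works because \<open>\<beta>\<close> is a crossed homomorphism along
  \<open>\<delta>\<close>.\<close>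

lemma end_eq_det_H:
  assumes "group H" "group K" "\<phi> \<in> hom K (AutoGroup H)"
    and \<theta>: "\<theta> \<in> hom (semidirect H K \<phi>) (semidirect H K \<phi>)"
    and bij: "bij_betw (end_delta H \<theta>) (carrier K) (carrier K)"
    and h: "h \<in> carrier H" and k: "k \<in> carrier K"
  defines "k' \<equiv> end_gamma K \<theta> h \<otimes>\<^bsub>K\<^esub> end_delta H \<theta> k"
  shows "\<theta> (h, k) =
    (det_H H K \<theta> h \<otimes>\<^bsub>H\<^esub> end_beta H \<theta> (inv_into (carrier K) (end_delta H \<theta>) k'), k')"
proof -
  interpret H: group H by fact
  interpret K: group K by fact
  note act = action_facts[OF assms(1-3)]
  note mat = end_matrix[OF assms(1-4)]
  let ?a = "end_alpha K \<theta>" and ?b = "end_beta H \<theta>"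
    and ?c = "end_gamma K \<theta>" and ?d = "end_delta H \<theta>"
  have \<theta>H: "\<theta> (u, \<one>\<^bsub>K\<^esub>) = (?a u, ?c u)" for u
    by (simp add: end_alpha_def end_gamma_def)
  have \<theta>K: "\<theta> (\<one>\<^bsub>H\<^esub>, v) = (?b v, ?d v)" for v
    by (simp add: end_beta_def end_delta_def)
  have mult: "\<theta> (u \<otimes>\<^bsub>H\<^esub> \<phi> v u', v \<otimes>\<^bsub>K\<^esub> v') = \<theta> (u, v) \<otimes>\<^bsub>semidirect H K \<phi>\<^esub> \<theta> (u', v')"
    if "u \<in> carrier H" "v \<in> carrier K" "u' \<in> carrier H" "v' \<in> carrier K" for u v u' v'
    using hom_mult[OF \<theta>, of "(u, v)" "(u', v')"] that by (simp add: semidirect_simps)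
  \<comment> \<open>\<open>x\<close> is the element of \<open>K\<close> for which
    \<open>\<theta>\<close> gives \<open>x\<close> and \<open>h\<close> the same
    \<open>K\<close>-component, so both twist what follows by the same automorphism
    \<open>\<phi> (?c h)\<close>.\<close>
  define x where "x = inv_into (carrier K) ?d (?c h)"
  have x: "x \<in> carrier K" and dx: "?d x = ?c h"
    using mat(1)[OF h] bij unfolding x_def
    by (metis bij_betw_imp_surj_on inv_into_into, metis bij_betw_inv_into_right)
  have "\<theta> (\<one>\<^bsub>H\<^esub>, x \<otimes>\<^bsub>K\<^esub> k) = \<theta> (\<one>\<^bsub>H\<^esub>, x) \<otimes>\<^bsub>semidirect H K \<phi>\<^esub> \<theta> (\<one>\<^bsub>H\<^esub>, k)"
    using mult[of "\<one>\<^bsub>H\<^esub>" x "\<one>\<^bsub>H\<^esub>" k] x k act(3) by simp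
  then have b: "?b (x \<otimes>\<^bsub>K\<^esub> k) = ?b x \<otimes>\<^bsub>H\<^esub> \<phi> (?c h) (?b k)" and d: "?d (x \<otimes>\<^bsub>K\<^esub> k) = k'"
    by (simp_all add: \<theta>K semidirect_simps dx k'_def)
  have inv: "inv_into (carrier K) ?d k' = x \<otimes>\<^bsub>K\<^esub> k"
    using bij_betw_inv_into_left[OF bij K.m_closed[OF x k]] d by simp
  have "\<theta> (h, k) = \<theta> (h, \<one>\<^bsub>K\<^esub>) \<otimes>\<^bsub>semidirect H K \<phi>\<^esub> \<theta> (\<one>\<^bsub>H\<^esub>, k)"
    using mult[of h "\<one>\<^bsub>K\<^esub>" "\<one>\<^bsub>H\<^esub>" k] h k act(3) by simp
  then have \<theta>hk: "\<theta> (h, k) = (?a h \<otimes>\<^bsub>H\<^esub> \<phi> (?c h) (?b k), k')"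
    by (simp add: \<theta>H \<theta>K semidirect_simps k'_def)
  \<comment> \<open>The inverse of \<open>?b x\<close> contained in \<open>det_H\<close> cancels the
    leading factor of \<open>?b\<close> at the product of \<open>x\<close> and \<open>k\<close>.
    What is left is exactly the twisted term in the first component of
    \<open>\<theta> (h, k)\<close>.\<close>
  have "inv\<^bsub>H\<^esub> ?b x \<otimes>\<^bsub>H\<^esub> (?b x \<otimes>\<^bsub>H\<^esub> \<phi> (?c h) (?b k)) = \<phi> (?c h) (?b k)"
    using mat(1)[OF h] mat(2)[OF x] mat(2)[OF k] act(2) by (simp flip: H.m_assoc)
  then have "det_H H K \<theta> h \<otimes>\<^bsub>H\<^esub> ?b (x \<otimes>\<^bsub>K\<^esub> k) = ?a h \<otimes>\<^bsub>H\<^esub> \<phi> (?c h) (?b k)"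
    using mat(1)[OF h] mat(2)[OF x] mat(2)[OF k] act(2)
    by (simp add: det_H_def b H.m_assoc flip: x_def)
  then show ?thesis
    by (simp add: \<theta>hk inv)
qed

theorem theorem3p3:
  fixes H :: "('a, 'c) monoid_scheme" and K :: "('b, 'd) monoid_scheme"
    and \<phi> :: "'b \<Rightarrow> 'a \<Rightarrow> 'a" and \<theta> :: "'a \<times> 'b \<Rightarrow> 'a \<times> 'b"
  assumes "group H" and "group K"
    and "\<phi> \<in> hom K (AutoGroup H)"
    and "\<theta> \<in> hom (semidirect H K \<phi>) (semidirect H K \<phi>)"
    and "bij_betw (end_delta H \<theta>) (carrier K) (carrier K)"
  shows "\<theta> \<in> iso (semidirect H K \<phi>) (semidirect H K \<phi>) \<longleftrightarrow>
         bij_betw (det_H H K \<theta>) (carrier H) (carrier H)"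
proof -
  interpret H: group H by fact
  interpret K: group K by fact
  note mat = end_matrix[OF assms(1-4)]
  note bij = assms(5)
  let ?D = "det_H H K \<theta>" and ?inv = "inv_into (carrier K) (end_delta H \<theta>)"
  \<comment> \<open>On the carrier \<open>\<theta>\<close> equals \<open>?R \<circ> ?Q\<close>:
    \<open>?Q\<close> changes only the \<open>K\<close>-coordinate, \<open>?R\<close> only the
    \<open>H\<close>-coordinate.\<close>
  let ?Q = "\<lambda>(h, k). (h, end_gamma K \<theta> h \<otimes>\<^bsub>K\<^esub> end_delta H \<theta> k)"
  let ?R = "\<lambda>(h, k). (?D h \<otimes>\<^bsub>H\<^esub> end_beta H \<theta> (?inv k), k)"
  have inv: "?inv k \<in> carrier K" if "k \<in> carrier K" for k
    using bij_betwE[OF bij_betw_inv_into[OF bij]] that by blast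
  have D: "?D ` carrier H \<subseteq> carrier H"
    using mat inv by (auto simp: det_H_def)
  \<comment> \<open>For fixed \<open>h\<close> the second coordinate is \<open>\<delta>\<close>
    followed by a left translation, hence bijective.\<close>
  have Q: "bij_betw ?Q (carrier H \<times> carrier K) (carrier H \<times> carrier K)"
  proof (rule bij_betw_skew)
    fix h assume "h \<in> carrier H"
    then show "bij_betw (\<lambda>k. end_gamma K \<theta> h \<otimes>\<^bsub>K\<^esub> end_delta H \<theta> k) (carrier K) (carrier K)"
      using bij_betw_trans[OF bij K.bij_betw_mult_left] mat(1) by (simp add: comp_def)
  qed
  \<comment> \<open>A right translation permutes \<open>H\<close>, so it can be stripped off on the
    outside; \<open>D\<close> ensures that the inner map lands in its domain.\<close>
  have trans: "bij_betw (\<lambda>h. ?D h \<otimes>\<^bsub>H\<^esub> end_beta H \<theta> (?inv k)) (carrier H) (carrier H) \<longleftrightarrow>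
      bij_betw ?D (carrier H) (carrier H)" if "k \<in> carrier K" for k
    using bij_betw_comp_iff2[OF H.bij_betw_mult_right D] mat(2)[OF inv[OF that]]
    unfolding comp_def by blast
  have "\<theta> \<in> iso (semidirect H K \<phi>) (semidirect H K \<phi>) \<longleftrightarrow>
      bij_betw \<theta> (carrier H \<times> carrier K) (carrier H \<times> carrier K)"
    using assms(4) by (simp add: iso_def semidirect_simps)
  also have "\<dots> \<longleftrightarrow> bij_betw (?R \<circ> ?Q) (carrier H \<times> carrier K) (carrier H \<times> carrier K)"
    using end_eq_det_H[OF assms] by (intro bij_betw_cong) auto
  also have "\<dots> \<longleftrightarrow> bij_betw ?R (carrier H \<times> carrier K) (carrier H \<times> carrier K)"
    using bij_betw_comp_iff[OF Q] by blast
  also have "\<dots> \<longleftrightarrow> bij_betw ?D (carrier H) (carrier H)"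
    \<comment> \<open>The condition over each fibre is the same. The unit of \<open>K\<close>
      supplies one fibre, so the universal statement is not vacuous.\<close>
    unfolding bij_betw_skew_iff using trans K.one_closed by blast
  finally show ?thesis .
qed

end
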